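(* Let $X$ be (the vertex set of) a connected infinite graph with bounded vertex degree, let $K\subseteq X$ be a finite set, and let $u:X\to[0,\infty)$ be an unbounded positive function which is harmonic and proper on $X\setminus K$, strictly positive on $X\setminus K$, and such that $u=0$ on $K$. Then the following Hardy-type inequality holds true: $$h(\varphi):=\frac12\sum_{\substack{(x,y)\in X\times X\\ x\sim y}}(\varphi(x)-\varphi(y))^2\;\ge\;\sum_{x\in X\setminus K}w(x)\varphi(x)^2$$ for all finitely supported functions $\varphi$ with support in $X\setminus K$, where the weight function $w$ is given by $$w(x):=\frac{1}{2u(x)}\sum_{y\in X,\,y\sim x}\left(u(x)^{1/2}-u(y)^{1/2}\right)^2,\qquad x\in X\setminus K.$$ Moreover, $w$ is an optimal Hardy-weight (for $h$) in $X\setminus K$.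
   Context: Graphs here have standard weights: $X$ is a countably infinite vertex set, $x\sim y$ means that $x,y$ are connected by an edge, and $\deg(x)$ is the number of vertices adjacent to $x$; bounded degree means $\sup_x\deg(x)<\infty$. A function $f:X\to\mathbb{R}$ is harmonic (superharmonic) on $W\subseteq X$ if $\Delta f(x):=\sum_{y\sim x}(f(x)-f(y))=0$ (resp. $\ge 0$) for all $x\in W$. A function $f:X\to\mathbb{R}$ is called proper on $W\subseteq X$ if $f^{-1}(I)$ is compact (i.e. finite) for all compact $I\subseteq f(W):=\{f(x)\mid x\in W\}$. For $W\subseteq X$, $C(W)$ is the space of real functions on $W$ and $C_c(W)$ the subspace of finitely supported ones; both are regarded as subspaces of $C(X)$ by extension by zero. A function is called positive if it is $\ge0$ and not identically $0$. Put $Y:=X\setminus K$. For $w:Y\to\mathbb{R}$ we also write $w(\varphi):=\sum_{x\in Y}w(x)\varphi(x)^2$ for the associated quadratic form. The form $h$ is considered on $C_c(Y)$. Optimal Hardy-weight. Let $w:Y\to[0,\infty)$ be positive with $h-w\ge0$ on $C_c(Y)$. * $h-w$ is critical in $Y$ if there is no positive $\tilde w\in C(Y)$ with $h-w-\tilde w\ge0$ on $C_c(Y)$. * $h-w$ is null-critical in $Y$ with respect to $w$ if it is critical in $Y$ and $\sum_{Y}\psi^2w=\infty$, where $\psi$ is the ground state of $h-w$ in $Y$, i.e. the unique (up to constant multiples) positive function on $Y$ which, extended by zero to $K$, satisfies $\Delta\psi-w\psi\ge0$ on $Y$ (in fact with equality). * $w$ is optimal near infinity for $h$ if for every $\lambda>0$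 and every finite $W\subseteq Y$ the inequality $h-w\ge\lambda w$ fails to hold on $C_c(Y\setminus W)$. $w$ is an optimal Hardy-weight for $h$ in $Y$ if $h-w$ is critical in $Y$, null-critical in $Y$ with respect to $w$, and $w$ is optimal near infinity for $h$.
   Formalization: Here "proper on X∖K" means that u^{-1}(I) is finite for every compact I in (0,∞), not only for compact I in u(X∖K); with the literal condition criticality can fail, e.g. when u tends to an unattained positive value along a transient tree. *)

theory Defs
  imports "HOL-Analysis.Analysis"
begin

text \<open>
  A graph is a symmetric irreflexive relation \<open>E\<close> on the type \<open>'a\<close>, so the vertex set is \<open>UNIV\<close>.
  Functions on a subset \<open>Y\<close> of the vertices are represented by functions on \<open>'a\<close>: either only
  their values on \<open>Y\<close> are used, or they are explicitly required to vanish off \<open>Y\<close>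
  (extension by zero).
\<close>

definition neighbours :: "('a \<Rightarrow> 'a \<Rightarrow> bool) \<Rightarrow> 'a \<Rightarrow> 'a set" where
  "neighbours E x = {y. E x y}"

definition connected_graph :: "('a \<Rightarrow> 'a \<Rightarrow> bool) \<Rightarrow> bool" where
  "connected_graph E \<longleftrightarrow> (\<forall>x y. E\<^sup>*\<^sup>* x y)"

text \<open>Finiteness is required separately because \<^const>\<open>card\<close> is \<open>0\<close> on infinite sets.\<close>

definition bounded_degree :: "('a \<Rightarrow> 'a \<Rightarrow> bool) \<Rightarrow> bool" where
  "bounded_degree E \<longleftrightarrow>
     (\<exists>D. \<forall>x. finite (neighbours E x) \<and> card (neighbours E x) \<le> D)"

definition laplacian :: "('a \<Rightarrow> 'a \<Rightarrow> bool) \<Rightarrow> ('a \<Rightarrow> real) \<Rightarrow> 'a \<Rightarrow> real" where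
  "laplacian E f x = (\<Sum>y\<in>neighbours E x. f x - f y)"

definition harmonic_on :: "('a \<Rightarrow> 'a \<Rightarrow> bool) \<Rightarrow> 'a set \<Rightarrow> ('a \<Rightarrow> real) \<Rightarrow> bool" where
  "harmonic_on E W f \<longleftrightarrow> (\<forall>x\<in>W. laplacian E f x = 0)"

text \<open>
  Properness of \<open>f\<close> on \<open>W\<close>, as a map with values in \<open>T\<close>. The range \<open>T\<close> of admissible values is a
  parameter because the image \<open>f ` W\<close> of a countable set is too thin to be used in its place:
  if the values of \<open>f\<close> accumulate at a point outside \<open>f ` W\<close>, the compact subsets of \<open>f ` W\<close> do not
  detect this. For a strictly positive function, \<open>T = {0<..}\<close>.
\<close>

definition proper_on :: "'a set \<Rightarrow> real set \<Rightarrow> ('a \<Rightarrow> real) \<Rightarrow> bool" where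
  "proper_on W T f \<longleftrightarrow>
     f ` W \<subseteq> T \<and> (\<forall>I. compact I \<and> I \<subseteq> T \<longrightarrow> finite (f -` I))"

definition positive_on :: "'a set \<Rightarrow> ('a \<Rightarrow> real) \<Rightarrow> bool" where
  "positive_on Y f \<longleftrightarrow> (\<forall>x\<in>Y. f x \<ge> 0) \<and> (\<exists>x\<in>Y. f x \<noteq> 0)"

definition C_c :: "'a set \<Rightarrow> ('a \<Rightarrow> real) set" where
  "C_c W = {\<phi>. finite {x. \<phi> x \<noteq> 0} \<and> (\<forall>x. x \<notin> W \<longrightarrow> \<phi> x = 0)}"

text \<open>The sum runs over ordered pairs, so each edge is counted twice.\<close>

definition energy :: "('a \<Rightarrow> 'a \<Rightarrow> bool) \<Rightarrow> ('a \<Rightarrow> real) \<Rightarrow> real" where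
  "energy E \<phi> = 1 / 2 * (\<Sum>\<^sub>\<infinity>(x, y)\<in>{(x, y). E x y}. (\<phi> x - \<phi> y)\<^sup>2)"

definition weight_form :: "'a set \<Rightarrow> ('a \<Rightarrow> real) \<Rightarrow> ('a \<Rightarrow> real) \<Rightarrow> real" where
  "weight_form Y w \<phi> = (\<Sum>\<^sub>\<infinity>x\<in>Y. w x * (\<phi> x)\<^sup>2)"

definition critical :: "('a \<Rightarrow> 'a \<Rightarrow> bool) \<Rightarrow> 'a set \<Rightarrow> ('a \<Rightarrow> real) \<Rightarrow> bool" where
  "critical E Y w \<longleftrightarrow>
     \<not> (\<exists>w'. positive_on Y w' \<and>
          (\<forall>\<phi>\<in>C_c Y. energy E \<phi> - weight_form Y w \<phi> - weight_form Y w' \<phi> \<ge> 0))"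

text \<open>
  If the subgraph on \<open>Y\<close> is connected and the form is critical, such a function exists and is unique
  up to constant multiples. If that subgraph is disconnected, the multiples can be chosen
  separately on each component.
\<close>

definition ground_state ::
  "('a \<Rightarrow> 'a \<Rightarrow> bool) \<Rightarrow> 'a set \<Rightarrow> ('a \<Rightarrow> real) \<Rightarrow> ('a \<Rightarrow> real) \<Rightarrow> bool" where
  "ground_state E Y w \<psi> \<longleftrightarrow>
     positive_on Y \<psi> \<and> (\<forall>x. x \<notin> Y \<longrightarrow> \<psi> x = 0) \<and>
     (\<forall>x\<in>Y. laplacian E \<psi> x - w x * \<psi> x \<ge> 0)"

text \<open>The divergence is required of every ground state, so that no choice of components matters.\<close>

definition null_critical :: "('a \<Rightarrow> 'a \<Rightarrow> bool) \<Rightarrow> 'a set \<Rightarrow> ('a \<Rightarrow> real) \<Rightarrow> bool" where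
  "null_critical E Y w \<longleftrightarrow>
     critical E Y w \<and>
     (\<exists>\<psi>. ground_state E Y w \<psi>) \<and>
     (\<forall>\<psi>. ground_state E Y w \<psi> \<longrightarrow> (\<Sum>\<^sub>\<infinity>x\<in>Y. ennreal ((\<psi> x)\<^sup>2 * w x)) = \<infinity>)"

definition optimal_near_infinity ::
  "('a \<Rightarrow> 'a \<Rightarrow> bool) \<Rightarrow> 'a set \<Rightarrow> ('a \<Rightarrow> real) \<Rightarrow> bool" where
  "optimal_near_infinity E Y w \<longleftrightarrow>
     (\<forall>c>0. \<forall>W. finite W \<and> W \<subseteq> Y \<longrightarrow>
        \<not> (\<forall>\<phi>\<in>C_c (Y - W). energy E \<phi> - weight_form Y w \<phi> \<ge> c * weight_form Y w \<phi>))"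

definition optimal_hardy_weight ::
  "('a \<Rightarrow> 'a \<Rightarrow> bool) \<Rightarrow> 'a set \<Rightarrow> ('a \<Rightarrow> real) \<Rightarrow> bool" where
  "optimal_hardy_weight E Y w \<longleftrightarrow>
     positive_on Y w \<and>
     (\<forall>\<phi>\<in>C_c Y. energy E \<phi> - weight_form Y w \<phi> \<ge> 0) \<and>
     critical E Y w \<and> null_critical E Y w \<and> optimal_near_infinity E Y w"

text \<open>Only used where \<open>u x > 0\<close>; elsewhere the division convention makes the value \<open>0\<close>.\<close>

definition hardy_weight :: "('a \<Rightarrow> 'a \<Rightarrow> bool) \<Rightarrow> ('a \<Rightarrow> real) \<Rightarrow> 'a \<Rightarrow> real" where
  "hardy_weight E u x =
     1 / (2 * u x) * (\<Sum>y\<in>neighbours E x. (sqrt (u x) - sqrt (u y))\<^sup>2)"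

end

theory Submission
  imports Defs
begin

text \<open>
  Write \<open>f = \<surd>u\<close>. Since \<open>u\<close> is harmonic on \<open>X - K\<close>, \<open>\<Delta>f = w f\<close> there, and the ground state transform
  \<open>h(f\<psi>) - w(f\<psi>) = \<onehalf> \<Sum> f(x) f(y) (\<psi>(x) - \<psi>(y))\<^sup>2\<close> gives the Hardy inequality. By harmonicity and properness,
  the flux \<open>\<Sum> (u(x) - u(y)) (r(u(x)) - r(u(y)))\<close> is the same positive number for all functions \<open>r\<close>
  increasing from \<open>0\<close> to \<open>1\<close> inside a compact part of \<open>(0, \<infinity>)\<close>. For \<open>r\<close> a linear ramp of width \<open>L\<close> in
  \<open>ln u\<close>, this bounds the energy of \<open>f\<close> times a difference of two ramps by a multiple of \<open>1/L\<close>, while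
  \<open>\<Sum> u w\<close> over a region where \<open>ln u\<close> ranges over an interval of length \<open>R\<close> is at least a multiple of \<open>R\<close>.
  Letting \<open>L \<rightarrow> \<infinity>\<close> gives criticality and forces every ground state to be proportional to \<open>f\<close> on each
  component where it does not vanish; the divergence of \<open>\<Sum> u w\<close> gives null-criticality; and with
  \<open>L = 1\<close> and \<open>R \<rightarrow> \<infinity>\<close> the form stays bounded while \<open>w(\<phi>)\<close> diverges, which is optimality near infinity.
\<close>

section \<open>Summation by parts\<close>

lemma infsum_eq_sum_neutral:
  assumes "finite N" "N \<subseteq> A" "\<And>x. x \<in> A - N \<Longrightarrow> f x = 0"
  shows "infsum f A = sum f N"
  using has_sum_finite_neutralI[OF assms refl] by (rule infsumI)

text \<open>Splitting the factor \<open>p x - p y\<close> leaves two finite sums, which the swap of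
  ordered pairs carries into each other. Their common value is the sum over \<open>N\<close>, hence
  the factor 2.\<close>

lemma green_has_sum:
  fixes p q :: "'a \<Rightarrow> real"
  assumes sym: "symp E" and fin: "\<And>x. finite (neighbours E x)"
    and N: "finite N" "\<And>x. x \<notin> N \<Longrightarrow> p x = 0"
  shows "((\<lambda>(x, y). (q x - q y) * (p x - p y)) has_sum 2 * (\<Sum>x\<in>N. p x * laplacian E q x))
           {(x, y). E x y}"
proof -
  define s where "s = (\<Sum>x\<in>N. p x * laplacian E q x)"
  have 1: "((\<lambda>(x, y). p x * (q x - q y)) has_sum s) {(x, y). E x y}"
  proof (rule has_sum_finite_neutralI)
    show "finite (Sigma N (neighbours E))" using N fin by auto
    show "s = (\<Sum>(x, y)\<in>Sigma N (neighbours E). p x * (q x - q y))"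
      unfolding s_def laplacian_def using N fin by (subst sum.Sigma[symmetric]) (auto simp: sum_distrib_left)
  qed (use N(2) in \<open>force simp: neighbours_def\<close>)+
  have "bij_betw prod.swap {(x, y). E x y} {(x, y). E x y}"
    by (rule bij_betwI[where g = prod.swap]) (use sym in \<open>auto dest: sympD\<close>)
  from has_sum_reindex_bij_betw[OF this, of "\<lambda>(x, y). p x * (q x - q y)" s] 1
  have 2: "((\<lambda>(x, y). p y * (q y - q x)) has_sum s) {(x, y). E x y}"
    by (simp add: case_prod_unfold)
  have "((\<lambda>e. (case e of (x, y) \<Rightarrow> p x * (q x - q y)) + (case e of (x, y) \<Rightarrow> p y * (q y - q x)))
           has_sum s + s) {(x, y). E x y}"
    by (rule has_sum_add[OF 1 2])
  then show ?thesis
    by (simp add: s_def case_prod_unfold algebra_simps)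
qed

text \<open>Two uses of Green's formula: \<open>\<phi>\<close> against itself gives the energy, and
  \<open>p\<close> against \<open>\<phi>\<close>-squared over \<open>p\<close> gives the Laplacian
  term. Their difference is the stated square edge by edge. Where \<open>p\<close> vanishes so does
  \<open>\<phi>\<close>, and with division by zero giving 0 the identity persists there. It is
  applied to the square root of \<open>u\<close> and to arbitrary ground states.\<close>

lemma ground_state_transform:
  fixes p \<phi> :: "'a \<Rightarrow> real"
  assumes sym: "symp E" and fin: "\<And>x. finite (neighbours E x)"
    and N: "finite N" "\<And>x. x \<notin> N \<Longrightarrow> \<phi> x = 0" and p: "\<And>x. p x = 0 \<Longrightarrow> \<phi> x = 0"
  shows "((\<lambda>(x, y). p x * p y * (\<phi> x / p x - \<phi> y / p y)\<^sup>2)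
           has_sum 2 * (energy E \<phi> - (\<Sum>x\<in>N. (\<phi> x)\<^sup>2 / p x * laplacian E p x))) {(x, y). E x y}"
proof -
  have "((\<lambda>(x, y). (\<phi> x - \<phi> y) * (\<phi> x - \<phi> y)) has_sum 2 * (\<Sum>x\<in>N. \<phi> x * laplacian E \<phi> x))
           {(x, y). E x y}"
    by (rule green_has_sum[OF sym fin N])
  then have 1: "((\<lambda>(x, y). (\<phi> x - \<phi> y)\<^sup>2) has_sum 2 * energy E \<phi>) {(x, y). E x y}"
    by (simp add: energy_def power2_eq_square infsumI)
  have 2: "((\<lambda>(x, y). (p x - p y) * ((\<phi> x)\<^sup>2 / p x - (\<phi> y)\<^sup>2 / p y)) has_sum
         2 * (\<Sum>x\<in>N. (\<phi> x)\<^sup>2 / p x * laplacian E p x)) {(x, y). E x y}"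
    by (rule green_has_sum[OF sym fin N(1)]) (simp add: N)
  have "((\<lambda>e. (case e of (x, y) \<Rightarrow> (\<phi> x - \<phi> y)\<^sup>2) -
            (case e of (x, y) \<Rightarrow> (p x - p y) * ((\<phi> x)\<^sup>2 / p x - (\<phi> y)\<^sup>2 / p y))) has_sum
         2 * energy E \<phi> - 2 * (\<Sum>x\<in>N. (\<phi> x)\<^sup>2 / p x * laplacian E p x)) {(x, y). E x y}"
    using has_sum_add[OF 1 has_sum_uminusI[OF 2]] by simp
  moreover have "(\<phi> x - \<phi> y)\<^sup>2 - (p x - p y) * ((\<phi> x)\<^sup>2 / p x - (\<phi> y)\<^sup>2 / p y) =
      p x * p y * (\<phi> x / p x - \<phi> y / p y)\<^sup>2" for x y
    using p[of x] p[of y]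
    by (cases "p x = 0"; cases "p y = 0") (auto simp: field_simps power2_eq_square)
  ultimately show ?thesis
    by (simp add: case_prod_unfold right_diff_distrib)
qed

section \<open>Logarithmic ramps and elementary inequalities for them\<close>

text \<open>The value for \<open>t \<le> 0\<close> is set by hand to the limit at 0 from the right,
  because the conventional value of \<open>ln\<close> there need not produce it.\<close>

definition log_ramp :: "real \<Rightarrow> real \<Rightarrow> real \<Rightarrow> real" where
  "log_ramp \<alpha> L t = (if t \<le> 0 then 0 else max 0 (min 1 ((ln t - \<alpha>) / L)))"

lemma log_ramp_mono:
  assumes "s \<le> t" "L > 0"
  shows "log_ramp \<alpha> L s \<le> log_ramp \<alpha> L t"
proof (cases "s \<le> 0")
  case False
  then have "(ln s - \<alpha>) / L \<le> (ln t - \<alpha>) / L"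
    using assms by (intro divide_right_mono) auto
  then show ?thesis using False assms by (auto simp: log_ramp_def)
qed (auto simp: log_ramp_def)

lemma log_ramp_eq_0_iff:
  assumes "t > 0" "L > 0"
  shows "log_ramp \<alpha> L t = 0 \<longleftrightarrow> t \<le> exp \<alpha>"
proof -
  have "t \<le> exp \<alpha> \<longleftrightarrow> ln t \<le> \<alpha>" using assms by (metis exp_le_cancel_iff exp_ln)
  moreover have "max 0 (min 1 a) = 0 \<longleftrightarrow> a \<le> 0" for a :: real by auto
  then have "log_ramp \<alpha> L t = 0 \<longleftrightarrow> (ln t - \<alpha>) / L \<le> 0"
    using assms by (simp only: log_ramp_def) simp
  ultimately show ?thesis using assms by (simp add: divide_le_0_iff)
qed

lemma log_ramp_eq_1_iff:
  assumes "t > 0" "L > 0"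
  shows "log_ramp \<alpha> L t = 1 \<longleftrightarrow> exp (\<alpha> + L) \<le> t"
proof -
  have "exp (\<alpha> + L) \<le> t \<longleftrightarrow> \<alpha> + L \<le> ln t" using assms by (metis exp_le_cancel_iff exp_ln)
  also have "\<dots> \<longleftrightarrow> 1 \<le> (ln t - \<alpha>) / L" using assms by (auto simp: field_simps)
  finally show ?thesis using assms by (auto simp: log_ramp_def max_def min_def)
qed

lemma log_ramp_lipschitz:
  assumes "s > 0" "t > 0" "L > 0"
  shows "L * \<bar>log_ramp \<alpha> L s - log_ramp \<alpha> L t\<bar> \<le> \<bar>ln s - ln t\<bar>"
proof -
  have "\<bar>log_ramp \<alpha> L s - log_ramp \<alpha> L t\<bar> \<le> \<bar>(ln s - \<alpha>) / L - (ln t - \<alpha>) / L\<bar>"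
  proof -
    have "\<bar>max 0 (min 1 a) - max 0 (min 1 b)\<bar> \<le> \<bar>a - b\<bar>" for a b :: real by auto
    then show ?thesis using assms by (simp add: log_ramp_def)
  qed
  also have "\<dots> = \<bar>ln s - ln t\<bar> / L"
    using assms by (simp flip: diff_divide_distrib)
  finally show ?thesis using assms by (simp add: field_simps)
qed

text \<open>Both bounds come from \<open>ln r \<le> r - 1\<close>, with \<open>r\<close> the ratio
  of the square roots. The first bounds the energy of a cutoff by the flux. The second bounds the
  flux by the Hardy weight, at the cost of a ratio that the Harnack constant controls.\<close>

lemma abs_ln_diff_le:
  assumes "0 < t" "0 < (s::real)"
  shows "sqrt s * sqrt t * \<bar>ln s - ln t\<bar> \<le> 2 * \<bar>s - t\<bar>"
    and "\<bar>s - t\<bar> * \<bar>ln s - ln t\<bar> \<le> 4 * (sqrt s - sqrt t)\<^sup>2 * (max s t / min s t)"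
proof -
  have *: "sqrt s * sqrt t * (ln s - ln t) \<le> 2 * (s - t) \<and>
     (s - t) * (ln s - ln t) \<le> 4 * (sqrt s - sqrt t)\<^sup>2 * (s / t)" if "0 < t" "t \<le> s" for s t :: real
  proof -
    define a b where "a = sqrt s" and "b = sqrt t"
    have ab: "0 < b" "b \<le> a" "s = a\<^sup>2" "t = b\<^sup>2" using that by (auto simp: a_def b_def)
    have "ln s - ln t = 2 * ln (a / b)" using ab by (simp add: ln_realpow ln_div)
    also have "\<dots> \<le> 2 * (a / b - 1)" using ab by (intro mult_left_mono ln_le_minus_one) auto
    also have "\<dots> = 2 * (a - b) / b" using ab by (simp add: field_simps)
    finally have l: "ln s - ln t \<le> 2 * (a - b) / b" .
    have "a * b * (ln s - ln t) \<le> a * b * (2 * (a - b) / b)"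
      using ab by (intro mult_left_mono l) auto
    also have "\<dots> = 2 * a * (a - b)" using ab by simp
    also have "\<dots> \<le> 2 * (a + b) * (a - b)" using ab by (intro mult_right_mono) auto
    also have "\<dots> = 2 * (s - t)" using ab by (simp add: power2_eq_square algebra_simps)
    finally have 1: "a * b * (ln s - ln t) \<le> 2 * (s - t)" .
    have "(s - t) * (ln s - ln t) \<le> (s - t) * (2 * (a - b) / b)"
      using that by (intro mult_left_mono l) auto
    also have "\<dots> = 2 * (a - b)\<^sup>2 * (a / b + 1)" using ab by (simp add: power2_eq_square field_simps)
    \<comment> \<open>As \<open>a / b\<close> is at least 1, both summands of
      \<open>a / b + 1\<close> are at most its square, which is \<open>s / t\<close>.\<close>
    also have "\<dots> \<le> 2 * (a - b)\<^sup>2 * (2 * ((a / b) * (a / b)))"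
    proof -
      have "1 \<le> a / b" using ab by simp
      then have "a / b * 1 \<le> a / b * (a / b)" by (intro mult_left_mono) auto
      then show ?thesis using \<open>1 \<le> a / b\<close> by (intro mult_left_mono) auto
    qed
    also have "\<dots> = 4 * (a - b)\<^sup>2 * (s / t)" using ab by (simp add: power2_eq_square)
    finally show ?thesis using 1 by (simp add: a_def b_def)
  qed
  show "sqrt s * sqrt t * \<bar>ln s - ln t\<bar> \<le> 2 * \<bar>s - t\<bar>"
    using *[of s t] *[of t s] assms by (cases "t \<le> s") (auto simp: abs_if mult.commute algebra_simps)
  show "\<bar>s - t\<bar> * \<bar>ln s - ln t\<bar> \<le> 4 * (sqrt s - sqrt t)\<^sup>2 * (max s t / min s t)"
  proof (cases "t \<le> s")
    case True
    then show ?thesis using *[of t s] assms by (simp add: abs_if)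
  next
    case False
    then have "(t - s) * (ln t - ln s) \<le> 4 * (sqrt t - sqrt s)\<^sup>2 * (t / s)"
      using *[of s t] assms by simp
    then show ?thesis using False assms by (simp add: abs_if power2_commute)
  qed
qed

section \<open>Flux through the level sets\<close>

text \<open>
  The function \<open>v\<close> is the restriction of \<open>u\<close> to a union of components of \<open>X - K\<close>, extended by zero.
  The degree bound \<open>D\<close> is also a Harnack constant for \<open>v\<close> on neighbours in \<open>{v > 0}\<close>.
\<close>

locale flux_graph =
  fixes E :: "'a \<Rightarrow> 'a \<Rightarrow> bool" and v :: "'a \<Rightarrow> real" and D :: real
  assumes infinite_UNIV: "infinite (UNIV :: 'a set)"
    and sym: "symp E" and conn: "connected_graph E"
    and fin: "finite (neighbours E x)" and deg: "real (card (neighbours E x)) \<le> D"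
    and D: "D \<ge> 1"
    and nonneg: "v x \<ge> 0"
    and harmonic: "v x > 0 \<Longrightarrow> laplacian E v x = 0"
    and level_finite: "a > 0 \<Longrightarrow> finite {x. a \<le> v x \<and> v x \<le> b}"
    and boundary_finite: "finite {y. v y > 0 \<and> (\<exists>x. E x y \<and> v x = 0)}"
    and pos: "\<exists>x. v x > 0"
begin

lemma E_sym: "E x y \<Longrightarrow> E y x"
  using sym by (rule sympD)

text \<open>Harnack inequality: by harmonicity the values at the neighbours add up to the degree
  times \<open>v x\<close>, and none of them is negative.\<close>

lemma neighbour_le:
  assumes "v x > 0" "E x y"
  shows "v y \<le> D * v x"
proof -
  have "v y \<le> (\<Sum>z\<in>neighbours E x. v z)"
    using assms nonneg fin by (intro member_le_sum) (auto simp: neighbours_def)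
  also have "\<dots> = real (card (neighbours E x)) * v x"
    using harmonic[OF assms(1)] by (simp add: laplacian_def sum_subtractf)
  also have "\<dots> \<le> D * v x" using deg nonneg by (intro mult_right_mono)
  finally show ?thesis .
qed

text \<open>The factors \<open>D\<close> make every edge inside \<open>{v > 0}\<close> on which the ramp changes lie in the annulus.\<close>

definition annulus :: "real \<Rightarrow> real \<Rightarrow> 'a set" where
  "annulus \<alpha> L = {x. exp \<alpha> / D \<le> v x \<and> v x \<le> D * exp (\<alpha> + L)}"

lemma finite_annulus: "finite (annulus \<alpha> L)"
  unfolding annulus_def using D by (intro level_finite) auto

lemma annulus_pos: "x \<in> annulus \<alpha> L \<Longrightarrow> v x > 0"
  using D by (auto simp: annulus_def intro: less_le_trans[of _ "exp \<alpha> / D"])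

text \<open>The share of one edge in the flux of \<open>v\<close> through its level sets, averaged
  over the levels by the increments of the ramp.\<close>

definition ramp_diff :: "real \<Rightarrow> real \<Rightarrow> 'a \<times> 'a \<Rightarrow> real" where
  "ramp_diff \<alpha> L = (\<lambda>(x, y). (v x - v y) * (log_ramp \<alpha> L (v x) - log_ramp \<alpha> L (v y)))"

lemma ramp_diff_eq_abs:
  assumes "L > 0"
  shows "ramp_diff \<alpha> L (x, y) = \<bar>v x - v y\<bar> * \<bar>log_ramp \<alpha> L (v x) - log_ramp \<alpha> L (v y)\<bar>"
  using log_ramp_mono[OF _ assms, of "v x" "v y" \<alpha>] log_ramp_mono[OF _ assms, of "v y" "v x" \<alpha>]
  by (cases "v x \<le> v y") (auto simp: ramp_diff_def abs_if algebra_simps)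

text \<open>If the ramp changes along an edge, the larger value exceeds \<open>exp \<alpha>\<close>
  and the smaller one lies below \<open>exp (\<alpha> + L)\<close>. Harnack then confines the other
  endpoint up to the factor \<open>D\<close>.\<close>

lemma annulus_if_ramp_neq:
  assumes "L > 0" "E x y" "v x > 0" "v y > 0" "log_ramp \<alpha> L (v x) \<noteq> log_ramp \<alpha> L (v y)"
  shows "x \<in> annulus \<alpha> L \<and> y \<in> annulus \<alpha> L"
proof -
  have *: "x \<in> annulus \<alpha> L \<and> y \<in> annulus \<alpha> L"
    if "E x y" "0 < v x" "0 < v y" "v x < v y" "log_ramp \<alpha> L (v x) \<noteq> log_ramp \<alpha> L (v y)" for x y
  proof -
    have "\<not> v y \<le> exp \<alpha>" "\<not> exp (\<alpha> + L) \<le> v x"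
      using that assms(1) log_ramp_eq_0_iff[of _ L \<alpha>] log_ramp_eq_1_iff[of _ L \<alpha>]
      by (metis less_le_not_le linear order_trans)+
    moreover have "v y \<le> D * v x" using neighbour_le that by blast
    moreover have "D * v x \<le> D * exp (\<alpha> + L)" using calculation D by simp
    moreover have "1 * v y \<le> D * v y" using D that by (intro mult_right_mono) auto
    moreover have "1 * exp (\<alpha> + L) \<le> D * exp (\<alpha> + L)" using D by (intro mult_right_mono) auto
    ultimately have "v x \<le> D * exp (\<alpha> + L)" "v y \<le> D * exp (\<alpha> + L)"
        "exp \<alpha> \<le> D * v x" "exp \<alpha> \<le> D * v y"
      by linarith+
    then show ?thesis using D by (simp add: annulus_def divide_le_eq mult.commute)
  qed
  show ?thesis
  proof (cases "v x < v y")
    case False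
    with assms have "v y < v x" by (cases "v x = v y") auto
    then show ?thesis using *[of y x] assms E_sym[of x y] by auto
  qed (use * assms in auto)
qed

text \<open>Edges inside \<open>{v > 0}\<close> matter only in the finite annulus, and edges leaving
  this set start at one of finitely many boundary vertices. This makes the flux a finite
  sum.\<close>

lemma ramp_diff_support:
  assumes "L > 0"
  shows "\<exists>A. finite A \<and> A \<subseteq> {(x, y). E x y} \<and> (\<forall>e\<in>{(x, y). E x y} - A. ramp_diff \<alpha> L e = 0)"
proof -
  define N where "N = annulus \<alpha> L \<union> {y. v y > 0 \<and> (\<exists>x. E x y \<and> v x = 0)}"
  define A where "A = Sigma N (neighbours E) \<union> prod.swap ` Sigma N (neighbours E)"
  have "finite A" using finite_annulus boundary_finite fin by (auto simp: A_def N_def)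
  moreover have "A \<subseteq> {(x, y). E x y}" by (auto simp: A_def neighbours_def E_sym)
  moreover have "ramp_diff \<alpha> L (x, y) = 0" if "E x y" "(x, y) \<notin> A" for x y
  proof -
    have "(x, y) \<in> A" if "x \<in> N \<or> y \<in> N"
      using that
    proof
      assume "x \<in> N"
      then show ?thesis using \<open>E x y\<close> by (auto simp: A_def neighbours_def)
    next
      assume "y \<in> N"
      then have "(y, x) \<in> Sigma N (neighbours E)"
        using E_sym[OF \<open>E x y\<close>] by (auto simp: neighbours_def)
      then have "prod.swap (y, x) \<in> A" unfolding A_def by blast
      then show ?thesis by simp
    qed
    with that have N: "x \<notin> N" "y \<notin> N" by blast+
    consider "v x > 0" "v y > 0" | "v x = 0" | "v y = 0"
      using nonneg[of x] nonneg[of y] by linarith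
    then have "v x = v y \<or> log_ramp \<alpha> L (v x) = log_ramp \<alpha> L (v y)"
    proof cases
      case 1
      then show ?thesis using annulus_if_ramp_neq[OF assms that(1)] N by (auto simp: N_def)
    next
      case 2
      then show ?thesis using N(2) that(1) nonneg[of y] by (auto simp: N_def)
    next
      case 3
      then show ?thesis using N(1) E_sym[OF that(1)] nonneg[of x] by (auto simp: N_def)
    qed
    then show ?thesis by (auto simp: ramp_diff_def)
  qed
  ultimately show ?thesis by auto
qed

text \<open>Summation by parts against the finitely supported difference of two ramps.\<close>

lemma ramp_diff_has_sum_indep:
  assumes "L > 0" "M > 0" "(ramp_diff \<alpha> L has_sum s) {(x, y). E x y}"
    "(ramp_diff \<beta> M has_sum t) {(x, y). E x y}"
  shows "s = t"
proof -
  define p where "p x = log_ramp \<alpha> L (v x) - log_ramp \<beta> M (v x)" for x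
  \<comment> \<open>Below this range both ramps are 0, above it both are 1. So \<open>p\<close> has
    finite support, although a single ramp need not.\<close>
  define N where "N = {x. exp (min \<alpha> \<beta>) \<le> v x \<and> v x \<le> exp (max (\<alpha> + L) (\<beta> + M))}"
  have "finite N" unfolding N_def by (rule level_finite) simp
  moreover have "p x = 0" if "x \<notin> N" for x
  proof (cases "v x > 0")
    case True
    from that consider "v x \<le> exp (min \<alpha> \<beta>)" | "exp (max (\<alpha> + L) (\<beta> + M)) \<le> v x"
      by (auto simp: N_def)
    then show ?thesis
    proof cases
      case 1
      then have "v x \<le> exp \<alpha>" "v x \<le> exp \<beta>" by (auto intro: order_trans)
      then have "log_ramp \<alpha> L (v x) = 0" "log_ramp \<beta> M (v x) = 0"
        using True assms by (simp_all add: log_ramp_eq_0_iff)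
      then show ?thesis by (simp add: p_def)
    next
      case 2
      then have "exp (\<alpha> + L) \<le> v x" "exp (\<beta> + M) \<le> v x" by (auto intro: order_trans[rotated])
      then show ?thesis using True assms log_ramp_eq_1_iff by (metis p_def cancel_comm_monoid_add_class.diff_cancel)
    qed
  qed (simp add: p_def log_ramp_def)
  ultimately have "((\<lambda>(x, y). (v x - v y) * (p x - p y)) has_sum 2 * (\<Sum>x\<in>N. p x * laplacian E v x))
      {(x, y). E x y}"
    by (rule green_has_sum[OF sym fin])
  \<comment> \<open>Where \<open>v\<close> is 0 its Laplacian need not vanish, but there both ramps
    do.\<close>
  moreover have "p x * laplacian E v x = 0" for x
    using harmonic[of x] nonneg[of x] by (cases "v x = 0") (auto simp: p_def log_ramp_def)
  moreover have "((\<lambda>(x, y). (v x - v y) * (p x - p y)) has_sum s - t) {(x, y). E x y}"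
    using has_sum_add[OF assms(3) has_sum_uminusI[OF assms(4)]]
    by (simp add: p_def ramp_diff_def case_prod_unfold algebra_simps)
  ultimately show ?thesis using has_sum_unique by fastforce
qed

text \<open>The ramp from 0 of width 1 is an arbitrary choice, by
  \<open>ramp_diff_has_sum_indep\<close>.\<close>

definition flux :: real where
  "flux = (\<Sum>\<^sub>\<infinity>e\<in>{(x, y). E x y}. ramp_diff 0 1 e)"

lemma flux_has_sum:
  assumes "L > 0"
  shows "(ramp_diff \<alpha> L has_sum flux) {(x, y). E x y}"
proof -
  have *: "(ramp_diff \<alpha> L has_sum infsum (ramp_diff \<alpha> L) {(x, y). E x y}) {(x, y). E x y}"
    if "L > 0" for \<alpha> L
    using ramp_diff_support[OF that] has_sum_finite_neutralI by (metis infsumI)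
  show ?thesis
    using ramp_diff_has_sum_indep[OF assms _ *[OF assms] *[of 1 0]] *[OF assms, of \<alpha>]
    by (simp add: flux_def)
qed

text \<open>All summands are nonnegative, so zero flux would make the ramp of \<open>v\<close>
  constant along every edge and, by connectedness, everywhere. But \<open>v\<close> is not constant,
  its positive level sets being finite, and a suitable ramp separates two of its values.\<close>

lemma flux_pos: "flux > 0"
proof -
  obtain x where x: "v x > 0" using pos by blast
  have "\<exists>y. v y \<noteq> v x"
  proof (rule ccontr)
    assume "\<not> ?thesis"
    then have eq: "v z = v x" for z by blast
    have "v x \<le> v z \<and> v z \<le> v x" for z by (simp only: eq[of z] order_refl)
    then have "{z. v x \<le> v z \<and> v z \<le> v x} = UNIV" by blast
    then show False using level_finite[OF x, of "v x"] infinite_UNIV by simp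
  qed
  then obtain y where y: "v y \<noteq> v x" by blast
  then have "v y < v x \<or> v x < v y" by linarith
  then obtain a b where ab: "v a < v b" by blast
  \<comment> \<open>The ramp is 0 at \<open>v a\<close> and positive at \<open>v b\<close>: it
    either starts at \<open>v a\<close> or, if \<open>v a = 0\<close>, is already complete at
    \<open>v b\<close>.\<close>
  define \<alpha> where "\<alpha> = (if v a = 0 then ln (v b) - 1 else ln (v a))"
  have b: "v b > 0" using ab nonneg[of a] by linarith
  have neq: "log_ramp \<alpha> 1 (v a) \<noteq> log_ramp \<alpha> 1 (v b)"
  proof (cases "v a = 0")
    case True
    then show ?thesis using b by (simp add: log_ramp_def \<alpha>_def)
  next
    case False
    then have "v a > 0" using nonneg[of a] by simp
    then show ?thesis
      using b ab log_ramp_eq_0_iff[of "v b" 1 \<alpha>] log_ramp_eq_0_iff[of "v a" 1 \<alpha>] by (simp add: \<alpha>_def)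
  qed
  have nn: "ramp_diff \<alpha> 1 (x, y) \<ge> 0" for x y by (subst ramp_diff_eq_abs) auto
  have "flux \<ge> 0"
    by (rule has_sum_nonneg[OF flux_has_sum[of 1 \<alpha>]]) (use nn in auto)
  moreover have "flux \<noteq> 0"
  proof
    assume "flux = 0"
    have step: "log_ramp \<alpha> 1 (v x) = log_ramp \<alpha> 1 (v y)" if "E x y" for x y
    proof -
      have "ramp_diff \<alpha> 1 (x, y) \<le> flux"
        using finite_sum_le_has_sum[OF flux_has_sum[of 1 \<alpha>], of "{(x, y)}"] that nn by auto
      then have "v x = v y \<or> log_ramp \<alpha> 1 (v x) = log_ramp \<alpha> 1 (v y)"
        using \<open>flux = 0\<close> ramp_diff_eq_abs[of 1 \<alpha> x y] by (auto simp: mult_le_0_iff)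
      then show ?thesis by auto
    qed
    have "E\<^sup>*\<^sup>* a b" using conn by (simp add: connected_graph_def)
    then have "log_ramp \<alpha> 1 (v a) = log_ramp \<alpha> 1 (v b)"
      by (induction rule: rtranclp_induct) (simp_all add: step)
    then show False using neq by simp
  qed
  ultimately show ?thesis by simp
qed

end

section \<open>Logarithmic cutoffs\<close>

definition log_cutoff :: "real \<Rightarrow> real \<Rightarrow> real \<Rightarrow> real \<Rightarrow> real" where
  "log_cutoff \<alpha> \<beta> L t = log_ramp \<alpha> L t - log_ramp \<beta> L t"

lemma log_cutoff_eq_0:
  assumes "L > 0" "t \<le> exp (min \<alpha> \<beta>) \<or> exp (max \<alpha> \<beta> + L) \<le> t"
  shows "log_cutoff \<alpha> \<beta> L t = 0"
proof (cases "t > 0")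
  case True
  have "exp (min \<alpha> \<beta>) \<le> exp \<alpha>" "exp (min \<alpha> \<beta>) \<le> exp \<beta>"
       "exp (\<alpha> + L) \<le> exp (max \<alpha> \<beta> + L)" "exp (\<beta> + L) \<le> exp (max \<alpha> \<beta> + L)" by simp_all
  then have "t \<le> exp \<alpha> \<and> t \<le> exp \<beta> \<or> exp (\<alpha> + L) \<le> t \<and> exp (\<beta> + L) \<le> t"
    using assms(2) by linarith
  then show ?thesis
    unfolding log_cutoff_def
    using True assms(1) log_ramp_eq_0_iff[OF True assms(1)] log_ramp_eq_1_iff[OF True assms(1)]
    by (metis cancel_comm_monoid_add_class.diff_cancel)
qed (simp add: log_cutoff_def log_ramp_def)

lemma log_cutoff_eq_1:
  assumes "L > 0" "exp (\<alpha> + L) \<le> t" "t \<le> exp \<beta>"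
  shows "log_cutoff \<alpha> \<beta> L t = 1"
proof -
  have "t > 0" using assms(2) by (meson exp_gt_zero less_le_trans)
  then have "log_ramp \<alpha> L t = 1" "log_ramp \<beta> L t = 0"
    using assms by (simp_all add: log_ramp_eq_0_iff log_ramp_eq_1_iff)
  then show ?thesis by (simp add: log_cutoff_def)
qed

text \<open>Only one factor of the square is estimated by the Lipschitz bound in the logarithm,
  which gains \<open>1 / L\<close> and absorbs the square roots. The other is split into the
  increments of the two ramps, so that flux terms remain.\<close>

lemma log_cutoff_le:
  assumes "0 < s" "0 < t" "0 < L"
  shows "sqrt s * sqrt t * (log_cutoff \<alpha> \<beta> L s - log_cutoff \<alpha> \<beta> L t)\<^sup>2 \<le>
     4 / L * (\<bar>s - t\<bar> * \<bar>log_ramp \<alpha> L s - log_ramp \<alpha> L t\<bar> + \<bar>s - t\<bar> * \<bar>log_ramp \<beta> L s - log_ramp \<beta> L t\<bar>)"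
proof -
  define a b d where "a = \<bar>log_ramp \<alpha> L s - log_ramp \<alpha> L t\<bar>"
    and "b = \<bar>log_ramp \<beta> L s - log_ramp \<beta> L t\<bar>"
    and "d = \<bar>log_cutoff \<alpha> \<beta> L s - log_cutoff \<alpha> \<beta> L t\<bar>"
  have d: "0 \<le> d" "d \<le> a + b" by (auto simp: a_def b_def d_def log_cutoff_def)
  have "L * a \<le> \<bar>ln s - ln t\<bar>" "L * b \<le> \<bar>ln s - ln t\<bar>"
    unfolding a_def b_def using assms by (auto intro: log_ramp_lipschitz)
  then have "L * (a + b) \<le> 2 * \<bar>ln s - ln t\<bar>" by (simp add: distrib_left)
  with d assms have "L * d \<le> 2 * \<bar>ln s - ln t\<bar>"
    using mult_left_mono[of d "a + b" L] by linarith
  have "L * (sqrt s * sqrt t * d\<^sup>2) = (sqrt s * sqrt t * (L * d)) * d"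
    by (simp add: power2_eq_square)
  also have "\<dots> \<le> (sqrt s * sqrt t * (2 * \<bar>ln s - ln t\<bar>)) * d"
    using d assms \<open>L * d \<le> _\<close> by (intro mult_right_mono mult_left_mono) auto
  also have "\<dots> = 2 * (sqrt s * sqrt t * \<bar>ln s - ln t\<bar>) * d" by simp
  also have "\<dots> \<le> 2 * (2 * \<bar>s - t\<bar>) * d"
    using d abs_ln_diff_le(1)[of t s] assms by (intro mult_right_mono mult_left_mono) auto
  also have "\<dots> \<le> 2 * (2 * \<bar>s - t\<bar>) * (a + b)" using d by (intro mult_left_mono) auto
  finally have "sqrt s * sqrt t * d\<^sup>2 \<le> 2 * (2 * \<bar>s - t\<bar>) * (a + b) / L"
    using assms by (simp add: pos_le_divide_eq mult.commute)
  also have "2 * (2 * \<bar>s - t\<bar>) * (a + b) / L = 4 / L * (\<bar>s - t\<bar> * a + \<bar>s - t\<bar> * b)"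
    by (simp add: distrib_left add_divide_distrib)
  finally show ?thesis by (simp only: a_def b_def d_def power2_abs)
qed

lemma weight_form_eq_sum:
  assumes "finite N" "\<And>x. x \<in> Y \<Longrightarrow> x \<notin> N \<Longrightarrow> \<phi> x = 0" "\<And>x. x \<in> N \<Longrightarrow> x \<notin> Y \<Longrightarrow> \<phi> x = 0"
  shows "weight_form Y w \<phi> = (\<Sum>x\<in>N. w x * (\<phi> x)\<^sup>2)"
proof -
  have "weight_form Y w \<phi> = (\<Sum>x\<in>N \<inter> Y. w x * (\<phi> x)\<^sup>2)"
    unfolding weight_form_def by (rule infsum_eq_sum_neutral) (use assms in auto)
  also have "\<dots> = (\<Sum>x\<in>N. w x * (\<phi> x)\<^sup>2)"
    by (rule sum.mono_neutral_left) (use assms in auto)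
  finally show ?thesis .
qed

text \<open>Expanding the squares in the weight gives twice the Laplacian of the root, times the
  root, minus the Laplacian of \<open>u\<close>, which is 0.\<close>

lemma laplacian_sqrt:
  assumes "finite (neighbours E x)" "u x > 0" "\<And>y. u y \<ge> 0" "laplacian E u x = 0"
  shows "laplacian E (\<lambda>y. sqrt (u y)) x = hardy_weight E u x * sqrt (u x)"
proof -
  have *: "(sqrt (u x) - sqrt (u y))\<^sup>2 = 2 * sqrt (u x) * (sqrt (u x) - sqrt (u y)) - (u x - u y)" for y
    using assms(3)[of x] assms(3)[of y] by (simp add: power2_eq_square algebra_simps)
  have "(\<Sum>y\<in>neighbours E x. (sqrt (u x) - sqrt (u y))\<^sup>2) =
      2 * sqrt (u x) * laplacian E (\<lambda>y. sqrt (u y)) x - laplacian E u x"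
    unfolding * laplacian_def by (simp only: sum_subtractf[symmetric] sum_distrib_left)
  then show ?thesis using assms by (simp add: hardy_weight_def field_simps)
qed

context flux_graph
begin

text \<open>The transform with the square root of \<open>v\<close> turns the left side into an edge
  sum, dominated by \<open>4 / L\<close> times two ramp sums. Each of these equals
  \<open>flux\<close>, so the bound does not see how long the plateau of the cutoff is.\<close>

lemma energy_cutoff_le:
  fixes \<alpha> \<beta> L :: real
  assumes L: "L > 0" and Y: "\<And>x. v x > 0 \<Longrightarrow> x \<in> Y \<and> w x = hardy_weight E v x"
  defines "\<phi> \<equiv> \<lambda>x. sqrt (v x) * log_cutoff \<alpha> \<beta> L (v x)"
  shows "finite {x. \<phi> x \<noteq> 0}" and "energy E \<phi> - weight_form Y w \<phi> \<le> 4 * flux / L"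
proof -
  define N where "N = {x. exp (min \<alpha> \<beta>) \<le> v x \<and> v x \<le> exp (max \<alpha> \<beta> + L)}"
  have "\<phi> x = 0" if "x \<notin> N" for x
    using that log_cutoff_eq_0[OF L, of "v x" \<alpha> \<beta>] by (auto simp: \<phi>_def N_def)
  moreover have "finite N" unfolding N_def by (rule level_finite) simp
  ultimately show finite: "finite {x. \<phi> x \<noteq> 0}" by (auto elim!: rev_finite_subset)
  define M where "M = {x. \<phi> x \<noteq> 0}"
  define p where "p x = sqrt (v x)" for x
  have M: "v x > 0" if "x \<in> M" for x
    using that nonneg[of x] by (auto simp: M_def \<phi>_def intro: ccontr)
  have "(\<phi> x)\<^sup>2 / p x * laplacian E p x = w x * (\<phi> x)\<^sup>2" if "x \<in> M" for x
  proof -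
    have "laplacian E p x = w x * p x"
      using laplacian_sqrt[where u = v, OF fin M[OF that] nonneg harmonic[OF M[OF that]]] Y[OF M[OF that]]
      by (simp add: p_def[abs_def])
    then show ?thesis using M[OF that] by (simp add: p_def)
  qed
  then have "(\<Sum>x\<in>M. (\<phi> x)\<^sup>2 / p x * laplacian E p x) = (\<Sum>x\<in>M. w x * (\<phi> x)\<^sup>2)"
    by (intro sum.cong) auto
  also have "\<dots> = weight_form Y w \<phi>"
    using finite M Y by (intro weight_form_eq_sum[symmetric]) (auto simp: M_def)
  finally have eq: "(\<Sum>x\<in>M. (\<phi> x)\<^sup>2 / p x * laplacian E p x) = weight_form Y w \<phi>" .
  have 1: "((\<lambda>(x, y). p x * p y * (\<phi> x / p x - \<phi> y / p y)\<^sup>2)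
           has_sum 2 * (energy E \<phi> - weight_form Y w \<phi>)) {(x, y). E x y}"
    unfolding eq[symmetric] using finite
    by (intro ground_state_transform[OF sym fin]) (auto simp: M_def p_def \<phi>_def)
  have 2: "((\<lambda>e. 4 / L * (ramp_diff \<alpha> L e + ramp_diff \<beta> L e)) has_sum 4 / L * (flux + flux)) {(x, y). E x y}"
    by (intro has_sum_cmult_right has_sum_add flux_has_sum L)
  have "p x * p y * (\<phi> x / p x - \<phi> y / p y)\<^sup>2 \<le> 4 / L * (ramp_diff \<alpha> L (x, y) + ramp_diff \<beta> L (x, y))" for x y
  proof (cases "v x > 0 \<and> v y > 0")
    case True
    then show ?thesis using log_cutoff_le[of "v x" "v y" L \<alpha> \<beta>] L
      by (simp add: p_def \<phi>_def ramp_diff_eq_abs)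
  next
    case False
    then have "p x * p y = 0" using nonneg[of x] nonneg[of y] by (auto simp: p_def)
    then have "p x * p y * (\<phi> x / p x - \<phi> y / p y)\<^sup>2 = 0" by (simp only: mult_zero_left)
    moreover have "0 \<le> 4 / L * (ramp_diff \<alpha> L (x, y) + ramp_diff \<beta> L (x, y))"
      using L by (simp add: ramp_diff_eq_abs)
    ultimately show ?thesis by linarith
  qed
  then have "2 * (energy E \<phi> - weight_form Y w \<phi>) \<le> 4 / L * (flux + flux)"
    using has_sum_mono[OF 1 2] by auto
  also have "\<dots> = 2 * (4 * flux / L)" by simp
  finally show "energy E \<phi> - weight_form Y w \<phi> \<le> 4 * flux / L"
    by (simp only: mult_le_cancel_left_pos zero_less_numeral)
qed

text \<open>For a ramp of width \<open>R\<close>, each flux term times \<open>R\<close> is at most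
  \<open>4 * D\<close> times the squared difference of the roots, by the Lipschitz bound and
  Harnack. Half the sum of these squares at \<open>x\<close> is \<open>v x\<close> times the weight,
  whence \<open>8 * D\<close>.\<close>

lemma hardy_mass_annulus_ge:
  "\<exists>\<alpha>\<^sub>0. \<forall>\<alpha>\<ge>\<alpha>\<^sub>0. \<forall>R>0. R * flux / (8 * D) \<le> (\<Sum>x\<in>annulus \<alpha> R. v x * hardy_weight E v x)"
proof (intro exI allI impI)
  define B where "B = {y. v y > 0 \<and> (\<exists>x. E x y \<and> v x = 0)}"
  fix \<alpha> R :: real
  \<comment> \<open>The witness is the sum of \<open>v\<close> over \<open>B\<close>. It makes
    \<open>exp \<alpha>\<close> exceed \<open>v\<close> on \<open>B\<close>, so the ramp vanishes at
    both ends of every edge meeting \<open>{v = 0}\<close>, where logarithms could not be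
    compared.\<close>
  assume \<alpha>: "(\<Sum>y\<in>B. v y) \<le> \<alpha>" and R: "R > 0"
  have zero: "ramp_diff \<alpha> R (x, y) = 0" if "E x y" "v x = 0 \<or> v y = 0" for x y
  proof -
    have "log_ramp \<alpha> R (v z) = 0" if "z = x \<or> z = y" for z
    proof (cases "v z = 0")
      case False
      then have "z \<in> B" using \<open>E x y\<close> \<open>v x = 0 \<or> v y = 0\<close> that E_sym nonneg[of z]
        by (auto simp: B_def)
      then have "v z \<le> (\<Sum>y\<in>B. v y)"
        using nonneg boundary_finite by (intro member_le_sum) (auto simp: B_def)
      also have "\<dots> \<le> exp \<alpha>" using \<alpha> exp_ge_add_one_self[of \<alpha>] by linarith
      finally show ?thesis using False nonneg[of z] R by (subst log_ramp_eq_0_iff) auto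
    qed (simp add: log_ramp_def)
    then show ?thesis by (simp add: ramp_diff_def)
  qed
  let ?S = "Sigma (annulus \<alpha> R) (neighbours E)"
  have "flux = (\<Sum>e\<in>?S. ramp_diff \<alpha> R e)"
  proof (rule has_sum_unique[OF flux_has_sum[OF R]], rule has_sum_finite_neutralI)
    show "ramp_diff \<alpha> R e = 0" if "e \<in> {(x, y). E x y} - ?S" for e
      using that zero annulus_if_ramp_neq[OF R] nonneg
      by (auto simp: neighbours_def ramp_diff_def order_less_le split: prod.splits) metis
  qed (use finite_annulus fin in \<open>auto simp: neighbours_def\<close>)
  then have "R * flux = (\<Sum>e\<in>?S. R * ramp_diff \<alpha> R e)" by (simp add: sum_distrib_left)
  also have "\<dots> \<le> (\<Sum>(x, y)\<in>?S. 4 * D * (sqrt (v x) - sqrt (v y))\<^sup>2)"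
  proof (rule sum_mono, clarify)
    fix x y assume xy: "x \<in> annulus \<alpha> R" "y \<in> neighbours E x"
    then have vx: "v x > 0" and E: "E x y" by (auto simp: annulus_pos neighbours_def)
    show "R * ramp_diff \<alpha> R (x, y) \<le> 4 * D * (sqrt (v x) - sqrt (v y))\<^sup>2"
    proof (cases "v y = 0")
      case True
      then show ?thesis using zero[OF E] D by simp
    next
      case False
      then have vy: "v y > 0" using nonneg[of y] by simp
      have "max (v x) (v y) / min (v x) (v y) \<le> D"
        using neighbour_le[OF vx E] neighbour_le[OF vy E_sym[OF E]] vx vy
        by (auto simp: max_def min_def divide_le_eq)
      have "R * ramp_diff \<alpha> R (x, y) =
          \<bar>v x - v y\<bar> * (R * \<bar>log_ramp \<alpha> R (v x) - log_ramp \<alpha> R (v y)\<bar>)"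
        using R by (simp add: ramp_diff_eq_abs)
      also have "\<dots> \<le> \<bar>v x - v y\<bar> * \<bar>ln (v x) - ln (v y)\<bar>"
        using vx vy R by (intro mult_left_mono log_ramp_lipschitz) auto
      also have "\<dots> \<le> 4 * (sqrt (v x) - sqrt (v y))\<^sup>2 * (max (v x) (v y) / min (v x) (v y))"
        using vx vy by (rule abs_ln_diff_le(2)[rotated])
      also have "\<dots> \<le> 4 * (sqrt (v x) - sqrt (v y))\<^sup>2 * D"
        by (intro mult_left_mono) (use \<open>_ \<le> D\<close> in auto)
      finally show ?thesis by (simp add: mult_ac)
    qed
  qed
  also have "\<dots> = (\<Sum>x\<in>annulus \<alpha> R. 8 * D * (v x * hardy_weight E v x))"
    using finite_annulus fin
    by (subst sum.Sigma[symmetric])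
       (auto intro!: sum.cong simp: hardy_weight_def sum_distrib_left dest: annulus_pos)
  finally show "R * flux / (8 * D) \<le> (\<Sum>x\<in>annulus \<alpha> R. v x * hardy_weight E v x)"
    using D by (simp add: divide_le_eq sum_distrib_left[symmetric] mult.commute)
qed

end

section \<open>Optimality of the Hardy weight\<close>

lemma weight_form_ge:
  assumes "\<phi> \<in> C_c Y" "\<And>x. x \<in> Y \<Longrightarrow> w x \<ge> 0" "finite A" "A \<subseteq> Y"
  shows "(\<Sum>x\<in>A. w x * (\<phi> x)\<^sup>2) \<le> weight_form Y w \<phi>"
proof -
  have fin: "finite (A \<union> {x. \<phi> x \<noteq> 0})" and sub: "A \<union> {x. \<phi> x \<noteq> 0} \<subseteq> Y"
    using assms by (auto simp: C_c_def)
  have "(\<Sum>x\<in>A. w x * (\<phi> x)\<^sup>2) \<le> (\<Sum>x\<in>A \<union> {x. \<phi> x \<noteq> 0}. w x * (\<phi> x)\<^sup>2)"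
    using assms sub by (intro sum_mono2 fin) auto
  also have "\<dots> = weight_form Y w \<phi>"
    using sub by (intro weight_form_eq_sum[symmetric] fin) auto
  finally show ?thesis .
qed

lemma nonpos_if_multiples_bounded:
  fixes a b L\<^sub>0 :: real
  assumes "\<And>L. L \<ge> L\<^sub>0 \<Longrightarrow> L * a \<le> b"
  shows "a \<le> 0"
proof (rule ccontr)
  assume "\<not> a \<le> 0"
  then have "(\<bar>b\<bar> + 1) / a * a \<le> max L\<^sub>0 ((\<bar>b\<bar> + 1) / a) * a" by (intro mult_right_mono) auto
  also have "\<dots> \<le> b" by (rule assms) simp
  finally show False using \<open>\<not> a \<le> 0\<close> by simp
qed

text \<open>Starting the rise at \<open>- 2 * L\<close> leaves a plateau from
  \<open>exp (- L)\<close> to \<open>exp L\<close>, which exhausts the positive reals as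
  \<open>L\<close> grows.\<close>

lemma log_cutoff_symmetric_eq_1:
  assumes "t > 0" "\<bar>ln t\<bar> \<le> L" "L > 0"
  shows "log_cutoff (- 2 * L) L L t = 1"
proof (rule log_cutoff_eq_1)
  have "exp (- L) \<le> exp (ln t)" "exp (ln t) \<le> exp L" using assms(2) by (auto simp: abs_le_iff)
  then show "exp (- 2 * L + L) \<le> t" "t \<le> exp L" using assms(1) by auto
qed (use assms in simp)

locale proper_harmonic =
  fixes E :: "'a \<Rightarrow> 'a \<Rightarrow> bool" and K :: "'a set" and u :: "'a \<Rightarrow> real" and D :: real
  assumes infinite_UNIV: "infinite (UNIV :: 'a set)"
    and sym: "symp E" and conn: "connected_graph E"
    and fin: "finite (neighbours E x)" and deg: "real (card (neighbours E x)) \<le> D"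
    and D: "D \<ge> 1"
    and finite_K: "finite K"
    and harmonic: "x \<notin> K \<Longrightarrow> laplacian E u x = 0"
    and u_pos: "x \<notin> K \<Longrightarrow> u x > 0" and u_zero: "x \<in> K \<Longrightarrow> u x = 0"
    and level_finite: "a > 0 \<Longrightarrow> finite {x. a \<le> u x \<and> u x \<le> b}"
begin

lemma u_nonneg: "u x \<ge> 0"
  using u_pos[of x] u_zero[of x] by (cases "x \<in> K") auto

lemma hardy_weight_nonneg: "hardy_weight E u x \<ge> 0"
  using u_nonneg[of x] by (simp add: hardy_weight_def sum_nonneg)

section \<open>Restriction to unions of components of the complement of \<open>K\<close>\<close>

text \<open>Closure under edges outside \<open>K\<close> describes nonempty unions of components
  without paths. They are needed because the complement of \<open>K\<close> may be disconnected and
  a ground state may vanish on some components.\<close>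

definition union_of_components :: "'a set \<Rightarrow> bool" where
  "union_of_components C \<longleftrightarrow> C \<noteq> {} \<and> C \<subseteq> - K \<and> (\<forall>x\<in>C. \<forall>y. E x y \<and> y \<notin> K \<longrightarrow> y \<in> C)"

definition restrict_u :: "'a set \<Rightarrow> 'a \<Rightarrow> real" where
  "restrict_u C x = (if x \<in> C then u x else 0)"

text \<open>A neighbour of \<open>C\<close> outside \<open>C\<close> lies in \<open>K\<close>, where
  \<open>u\<close> is 0 anyway. Hence the restriction preserves the Laplacian and the weight on
  \<open>C\<close>.\<close>

lemma restrict_u_neighbour:
  "union_of_components C \<Longrightarrow> x \<in> C \<Longrightarrow> E x y \<Longrightarrow> restrict_u C y = u y"
  using u_zero[of y] by (auto simp: restrict_u_def union_of_components_def)

lemma restrict_u_pos_iff: "union_of_components C \<Longrightarrow> restrict_u C x > 0 \<longleftrightarrow> x \<in> C"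
  using u_pos[of x] by (auto simp: restrict_u_def union_of_components_def)

lemma hardy_weight_restrict_u:
  assumes "union_of_components C" "x \<in> C"
  shows "hardy_weight E (restrict_u C) x = hardy_weight E u x"
proof -
  have "(\<Sum>y\<in>neighbours E x. (sqrt (restrict_u C x) - sqrt (restrict_u C y))\<^sup>2) =
      (\<Sum>y\<in>neighbours E x. (sqrt (u x) - sqrt (u y))\<^sup>2)"
    using restrict_u_neighbour[OF assms] assms(2)
    by (intro sum.cong) (simp_all add: neighbours_def, simp add: restrict_u_def)
  then show ?thesis using assms(2) by (simp add: hardy_weight_def restrict_u_def)
qed

lemma flux_graph_restrict_u:
  assumes C: "union_of_components C"
  shows "flux_graph E (restrict_u C) D"
proof
  show "restrict_u C x \<ge> 0" for x using u_nonneg by (simp add: restrict_u_def)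
  show "laplacian E (restrict_u C) x = 0" if "restrict_u C x > 0" for x
  proof -
    have x: "x \<in> C" "x \<notin> K" using that C restrict_u_pos_iff by (auto simp: union_of_components_def)
    have "laplacian E (restrict_u C) x = laplacian E u x"
      unfolding laplacian_def using x restrict_u_neighbour[OF C x(1)]
      by (intro sum.cong) (auto simp: neighbours_def restrict_u_def)
    then show ?thesis using harmonic x by simp
  qed
  show "finite {x. a \<le> restrict_u C x \<and> restrict_u C x \<le> b}" if "a > 0" for a b
    by (rule finite_subset[OF _ level_finite[OF that, of b]]) (use that in \<open>auto simp: restrict_u_def split: if_splits\<close>)
  \<comment> \<open>A vertex of \<open>C\<close> next to a zero of the restriction is next to
    \<open>K\<close>, which is finite.\<close>
  have "{y. restrict_u C y > 0 \<and> (\<exists>x. E x y \<and> restrict_u C x = 0)} \<subseteq> (\<Union>x\<in>K. neighbours E x)"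
    using restrict_u_pos_iff[OF C] restrict_u_neighbour[OF C] u_pos sym
    by (force simp: neighbours_def dest: sympD)
  then show "finite {y. restrict_u C y > 0 \<and> (\<exists>x. E x y \<and> restrict_u C x = 0)}"
    using finite_K fin by (auto elim!: finite_subset)
  show "\<exists>x. restrict_u C x > 0" using restrict_u_pos_iff[OF C] C by (auto simp: union_of_components_def)
qed (fact infinite_UNIV sym conn fin deg D)+

lemma flux_graph_u: "flux_graph E u D" and union_of_components_all: "union_of_components (- K)"
proof -
  have "- K \<noteq> {}" using finite_K infinite_UNIV by (metis double_complement Compl_empty_eq)
  then show *: "union_of_components (- K)" by (simp add: union_of_components_def)
  have "restrict_u (- K) = u" using u_zero by (auto simp: restrict_u_def)
  then show "flux_graph E u D" using flux_graph_restrict_u[OF *] by simp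
qed

lemma hardy_inequality:
  assumes "\<phi> \<in> C_c (- K)"
  shows "weight_form (- K) (hardy_weight E u) \<phi> \<le> energy E \<phi>"
proof -
  define N where "N = {x. \<phi> x \<noteq> 0}"
  have N: "finite N" "N \<subseteq> - K" using assms by (auto simp: C_c_def N_def)
  let ?p = "\<lambda>x. sqrt (u x)"
  have "weight_form (- K) (hardy_weight E u) \<phi> = (\<Sum>x\<in>N. hardy_weight E u x * (\<phi> x)\<^sup>2)"
    using N by (intro weight_form_eq_sum) (auto simp: N_def)
  also have "\<dots> = (\<Sum>x\<in>N. (\<phi> x)\<^sup>2 / ?p x * laplacian E ?p x)"
  proof (rule sum.cong)
    fix x assume "x \<in> N"
    then have "u x > 0" "laplacian E u x = 0" using N u_pos harmonic by auto
    then show "hardy_weight E u x * (\<phi> x)\<^sup>2 = (\<phi> x)\<^sup>2 / ?p x * laplacian E ?p x"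
      using laplacian_sqrt[where u = u, OF fin _ u_nonneg] by simp
  qed simp
  also have "\<dots> \<le> energy E \<phi>"
  proof -
    have "((\<lambda>(x, y). ?p x * ?p y * (\<phi> x / ?p x - \<phi> y / ?p y)\<^sup>2)
           has_sum 2 * (energy E \<phi> - (\<Sum>x\<in>N. (\<phi> x)\<^sup>2 / ?p x * laplacian E ?p x))) {(x, y). E x y}"
      using N u_pos by (intro ground_state_transform sym fin) (force simp: N_def)+
    then have "0 \<le> 2 * (energy E \<phi> - (\<Sum>x\<in>N. (\<phi> x)\<^sup>2 / ?p x * laplacian E ?p x))"
      by (rule has_sum_nonneg) (use u_nonneg in auto)
    then show ?thesis by simp
  qed
  finally show ?thesis .
qed

text \<open>
  The cutoffs \<open>\<surd>u \<cdot> log_cutoff (- 2 * L) L L \<circ> u\<close>, restricted to a union of components, form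
  a null sequence converging pointwise to \<open>\<surd>u\<close>.
\<close>

lemma null_sequence:
  assumes C: "union_of_components C"
  obtains \<phi> B where
    "\<And>L. L > 0 \<Longrightarrow> \<phi> L \<in> C_c C"
    "\<And>L. L > 0 \<Longrightarrow> L * (energy E (\<phi> L) - weight_form (- K) (hardy_weight E u) (\<phi> L)) \<le> B"
    "\<And>L x. x \<in> C \<Longrightarrow> L > 0 \<Longrightarrow> \<bar>ln (u x)\<bar> \<le> L \<Longrightarrow> \<phi> L x = sqrt (u x)"
proof -
  interpret flux_graph E "restrict_u C" D using C by (rule flux_graph_restrict_u)
  define \<phi> where "\<phi> L x = sqrt (restrict_u C x) * log_cutoff (- 2 * L) L L (restrict_u C x)" for L x
  have Y: "x \<in> - K \<and> hardy_weight E u x = hardy_weight E (restrict_u C) x" if "restrict_u C x > 0" for x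
    using that C by (auto simp: restrict_u_pos_iff hardy_weight_restrict_u union_of_components_def)
  have "\<phi> L \<in> C_c C" if "L > 0" for L
    using energy_cutoff_le(1)[where w = "hardy_weight E u", OF that Y]
    by (auto simp: C_c_def \<phi>_def[abs_def] restrict_u_def)
  moreover have "L * (energy E (\<phi> L) - weight_form (- K) (hardy_weight E u) (\<phi> L)) \<le> 4 * flux" if "L > 0" for L
    using energy_cutoff_le(2)[OF that Y, of "- 2 * L" L] that
    by (simp add: \<phi>_def[abs_def] pos_le_divide_eq mult.commute)
  moreover have "\<phi> L x = sqrt (u x)" if "x \<in> C" "L > 0" "\<bar>ln (u x)\<bar> \<le> L" for L x
    using that log_cutoff_symmetric_eq_1[of "u x" L] restrict_u_pos_iff[OF C, of x]
    by (simp add: \<phi>_def restrict_u_def)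
  ultimately show thesis by (rule that)
qed

text \<open>Along the null sequence, \<open>w' x * u x\<close> at a single vertex is at most
  \<open>B / L\<close> for all large \<open>L\<close>.\<close>

lemma critical_hardy_weight: "critical E (- K) (hardy_weight E u)"
  unfolding critical_def
proof
  assume "\<exists>w'. positive_on (- K) w' \<and> (\<forall>\<phi>\<in>C_c (- K).
      energy E \<phi> - weight_form (- K) (hardy_weight E u) \<phi> - weight_form (- K) w' \<phi> \<ge> 0)"
  then obtain w' where w'_pos: "positive_on (- K) w'"
    and ineq: "\<forall>\<phi>\<in>C_c (- K). energy E \<phi> - weight_form (- K) (hardy_weight E u) \<phi> - weight_form (- K) w' \<phi> \<ge> 0"
    by blast
  obtain x where x: "x \<notin> K" "w' x \<noteq> 0" and w': "\<And>x. x \<notin> K \<Longrightarrow> w' x \<ge> 0"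
    using w'_pos by (auto simp: positive_on_def)
  have le: "weight_form (- K) w' \<phi> \<le> energy E \<phi> - weight_form (- K) (hardy_weight E u) \<phi>"
    if "\<phi> \<in> C_c (- K)" for \<phi>
    using bspec[OF ineq that] by linarith
  obtain \<phi> B where \<phi>: "\<And>L. L > 0 \<Longrightarrow> \<phi> L \<in> C_c (- K)"
    "\<And>L. L > 0 \<Longrightarrow> L * (energy E (\<phi> L) - weight_form (- K) (hardy_weight E u) (\<phi> L)) \<le> B"
    "\<And>L x. x \<in> - K \<Longrightarrow> L > 0 \<Longrightarrow> \<bar>ln (u x)\<bar> \<le> L \<Longrightarrow> \<phi> L x = sqrt (u x)"
    using null_sequence[OF union_of_components_all] by blast
  have "w' x * u x \<le> 0"
  proof (rule nonpos_if_multiples_bounded)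
    fix L :: real assume L: "L \<ge> 1 + \<bar>ln (u x)\<bar>"
    then have "L > 0" by linarith
    have "w' x * u x = (\<Sum>y\<in>{x}. w' y * (\<phi> L y)\<^sup>2)"
      using \<phi>(3)[of x L] x L \<open>L > 0\<close> u_nonneg by simp
    also have "\<dots> \<le> weight_form (- K) w' (\<phi> L)"
      using x w' \<phi>(1)[OF \<open>L > 0\<close>] by (intro weight_form_ge) auto
    also have "\<dots> \<le> energy E (\<phi> L) - weight_form (- K) (hardy_weight E u) (\<phi> L)"
      by (rule le[OF \<phi>(1)[OF \<open>L > 0\<close>]])
    finally show "L * (w' x * u x) \<le> B"
      using \<open>L > 0\<close> \<phi>(2)[OF \<open>L > 0\<close>] by (meson less_imp_le mult_left_mono order_trans)
  qed
  then show False using w'[of x] x u_pos[of x] by (auto simp: mult_le_0_iff)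
qed

section \<open>Ground states and null-criticality\<close>

lemma ground_state_sqrt: "ground_state E (- K) (hardy_weight E u) (\<lambda>x. sqrt (u x))"
proof -
  obtain x where "x \<notin> K" using union_of_components_all by (auto simp: union_of_components_def)
  then have "positive_on (- K) (\<lambda>x. sqrt (u x))"
    using u_pos u_nonneg by (force simp: positive_on_def)
  moreover have "laplacian E (\<lambda>x. sqrt (u x)) x = hardy_weight E u x * sqrt (u x)" if "x \<notin> K" for x
    by (rule laplacian_sqrt) (use that fin u_pos u_nonneg harmonic in auto)
  ultimately show ?thesis by (auto simp: ground_state_def u_zero)
qed

text \<open>Minimum principle: at a zero outside \<open>K\<close> the supersolution inequality makes
  the sum over the neighbours nonpositive, so \<open>\<psi>\<close> vanishes at all of them.\<close>

lemma ground_state_support: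
  assumes "ground_state E (- K) (hardy_weight E u) \<psi>"
  shows "\<psi> x \<ge> 0" and "union_of_components {x. \<psi> x > 0}"
proof -
  show nonneg: "\<psi> x \<ge> 0" for x
    using assms by (cases "x \<in> K") (auto simp: ground_state_def positive_on_def)
  have "\<psi> y > 0" if "\<psi> x > 0" "E x y" "y \<notin> K" for x y
  proof (rule ccontr)
    assume "\<not> \<psi> y > 0"
    then have "\<psi> y = 0" using nonneg[of y] by simp
    then have "(\<Sum>z\<in>neighbours E y. \<psi> z) \<le> 0"
      using assms that by (force simp: ground_state_def laplacian_def sum_negf)
    moreover have "\<psi> x \<le> (\<Sum>z\<in>neighbours E y. \<psi> z)"
      using that sym nonneg fin by (intro member_le_sum) (auto simp: neighbours_def dest: sympD)
    ultimately show False using that by linarith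
  qed
  moreover have "x \<notin> K" if "\<psi> x > 0" for x using that assms by (auto simp: ground_state_def)
  moreover have "\<exists>x. \<psi> x > 0"
    using assms nonneg by (fastforce simp: ground_state_def positive_on_def less_le)
  ultimately show "union_of_components {x. \<psi> x > 0}" by (auto simp: union_of_components_def)
qed

text \<open>The null sequence is now measured by the transform with respect to
  \<open>\<psi>\<close>. As \<open>\<psi>\<close> is a supersolution, the transformed sum is at most
  twice the excess of energy over the weight form, hence at most \<open>2 * B / L\<close>. So the
  term of any fixed edge is 0.\<close>

lemma ground_state_proportional:
  assumes gs: "ground_state E (- K) (hardy_weight E u) \<psi>"
    and xy: "E x y" "\<psi> x > 0" "\<psi> y > 0"
  shows "sqrt (u x) / \<psi> x = sqrt (u y) / \<psi> y"
proof -
  note C = ground_state_support(2)[OF gs]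
  obtain \<phi> B where \<phi>: "\<And>L. L > 0 \<Longrightarrow> \<phi> L \<in> C_c {x. \<psi> x > 0}"
    "\<And>L. L > 0 \<Longrightarrow> L * (energy E (\<phi> L) - weight_form (- K) (hardy_weight E u) (\<phi> L)) \<le> B"
    "\<And>L x. x \<in> {x. \<psi> x > 0} \<Longrightarrow> L > 0 \<Longrightarrow> \<bar>ln (u x)\<bar> \<le> L \<Longrightarrow> \<phi> L x = sqrt (u x)"
    using null_sequence[OF C] by blast
  have "\<psi> x * \<psi> y * (sqrt (u x) / \<psi> x - sqrt (u y) / \<psi> y)\<^sup>2 \<le> 0" (is "?lhs \<le> 0")
  proof (rule nonpos_if_multiples_bounded)
    \<comment> \<open>Such \<open>L\<close> puts both endpoints on the plateau, and the term of this
      edge no longer depends on \<open>L\<close>.\<close>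
    fix L :: real assume L: "L \<ge> 1 + \<bar>ln (u x)\<bar> + \<bar>ln (u y)\<bar>"
    then have "L > 0" by linarith
    define N where "N = {x. \<phi> L x \<noteq> 0}"
    have N_pos: "\<psi> z > 0" if "z \<in> N" for z
      using \<phi>(1)[OF \<open>L > 0\<close>] that by (auto simp: C_c_def N_def)
    have "finite N" using \<phi>(1)[OF \<open>L > 0\<close>] by (auto simp: C_c_def N_def)
    have N_K: "N \<subseteq> - K" using N_pos C by (auto simp: union_of_components_def)
    have "weight_form (- K) (hardy_weight E u) (\<phi> L) = (\<Sum>z\<in>N. hardy_weight E u z * (\<phi> L z)\<^sup>2)"
      using \<open>finite N\<close> N_K by (intro weight_form_eq_sum) (auto simp: N_def)
    also have "\<dots> \<le> (\<Sum>z\<in>N. (\<phi> L z)\<^sup>2 / \<psi> z * laplacian E \<psi> z)"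
    proof (rule sum_mono)
      fix z assume z: "z \<in> N"
      have "(\<phi> L z)\<^sup>2 / \<psi> z * (hardy_weight E u z * \<psi> z) \<le> (\<phi> L z)\<^sup>2 / \<psi> z * laplacian E \<psi> z"
        using gs z N_K N_pos[OF z] by (intro mult_left_mono) (auto simp: ground_state_def)
      then show "hardy_weight E u z * (\<phi> L z)\<^sup>2 \<le> (\<phi> L z)\<^sup>2 / \<psi> z * laplacian E \<psi> z"
        using N_pos[OF z] by (simp add: mult.commute)
    qed
    finally have le: "weight_form (- K) (hardy_weight E u) (\<phi> L)
        \<le> (\<Sum>z\<in>N. (\<phi> L z)\<^sup>2 / \<psi> z * laplacian E \<psi> z)" .
    have sum: "((\<lambda>(x, y). \<psi> x * \<psi> y * (\<phi> L x / \<psi> x - \<phi> L y / \<psi> y)\<^sup>2) has_sum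
        2 * (energy E (\<phi> L) - (\<Sum>z\<in>N. (\<phi> L z)\<^sup>2 / \<psi> z * laplacian E \<psi> z))) {(x, y). E x y}"
      using \<open>finite N\<close> N_pos by (intro ground_state_transform sym fin) (force simp: N_def)+
    have "\<psi> x * \<psi> y * (\<phi> L x / \<psi> x - \<phi> L y / \<psi> y)\<^sup>2 \<le>
        2 * (energy E (\<phi> L) - (\<Sum>z\<in>N. (\<phi> L z)\<^sup>2 / \<psi> z * laplacian E \<psi> z))"
      using finite_sum_le_has_sum[OF sum, of "{(x, y)}"] xy ground_state_support(1)[OF gs] by auto
    then have "?lhs \<le> 2 * (energy E (\<phi> L) - weight_form (- K) (hardy_weight E u) (\<phi> L))"
      using \<phi>(3)[of x L] \<phi>(3)[of y L] xy L \<open>L > 0\<close> le by simp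
    then have "L * ?lhs \<le> L * (2 * (energy E (\<phi> L) - weight_form (- K) (hardy_weight E u) (\<phi> L)))"
      using \<open>L > 0\<close> by (intro mult_left_mono) auto
    then show "L * ?lhs \<le> 2 * B" using \<phi>(2)[OF \<open>L > 0\<close>] by linarith
  qed
  then show ?thesis using xy by (simp add: mult_le_0_iff)
qed

text \<open>On some union of components \<open>\<psi>\<close> is a constant multiple of the square
  root of \<open>u\<close>, and there the mass over annuli grows at least linearly in
  \<open>R\<close>.\<close>

lemma ground_state_mass_infinite:
  assumes gs: "ground_state E (- K) (hardy_weight E u) \<psi>"
  shows "(\<Sum>\<^sub>\<infinity>x\<in>- K. ennreal ((\<psi> x)\<^sup>2 * hardy_weight E u x)) = \<infinity>" (is "?S = _")
proof -
  note supp = ground_state_support(2)[OF gs]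
  then obtain x\<^sub>0 where x\<^sub>0: "\<psi> x\<^sub>0 > 0" by (auto simp: union_of_components_def)
  have "u x\<^sub>0 > 0" using x\<^sub>0 supp u_pos by (auto simp: union_of_components_def)
  define c where "c = \<psi> x\<^sub>0 / sqrt (u x\<^sub>0)"
  have c: "c > 0" using x\<^sub>0 \<open>u x\<^sub>0 > 0\<close> by (simp add: c_def)
  \<comment> \<open>Fixing the ratio found at one vertex gives a set closed under edges outside
    \<open>K\<close>, since the ratio is constant along edges.\<close>
  define C where "C = {x. \<psi> x > 0 \<and> \<psi> x = c * sqrt (u x)}"
  have "y \<in> C" if "x \<in> C" "E x y" "y \<notin> K" for x y
  proof -
    have x: "\<psi> x > 0" "\<psi> x = c * sqrt (u x)" using that by (auto simp: C_def)
    have y: "\<psi> y > 0" using supp that(2,3) x(1) unfolding union_of_components_def by blast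
    have "sqrt (u y) / \<psi> y = sqrt (u x) / \<psi> x"
      using ground_state_proportional[OF gs that(2)] x y by simp
    also have "\<dots> = 1 / c"
    proof -
      have "sqrt (u x) \<noteq> 0" using x by auto
      then show ?thesis unfolding x(2) by simp
    qed
    finally have "\<psi> y = c * sqrt (u y)" using y c by (simp add: divide_eq_eq mult.commute)
    then show ?thesis using y by (simp add: C_def)
  qed
  moreover have "x\<^sub>0 \<in> C" using x\<^sub>0 \<open>u x\<^sub>0 > 0\<close> by (simp add: C_def c_def)
  moreover have "C \<subseteq> - K" using supp by (auto simp: union_of_components_def C_def)
  ultimately have C: "union_of_components C" unfolding union_of_components_def by blast
  interpret flux_graph E "restrict_u C" D using C by (rule flux_graph_restrict_u)
  obtain \<alpha> where \<alpha>: "\<And>R. R > 0 \<Longrightarrow> R * flux / (8 * D) \<le>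
      (\<Sum>x\<in>annulus \<alpha> R. restrict_u C x * hardy_weight E (restrict_u C) x)"
    using hardy_mass_annulus_ge by blast
  have ge: "ennreal (R * (c\<^sup>2 * flux / (8 * D))) \<le> ?S" if "R > 0" for R
  proof -
    have sub: "annulus \<alpha> R \<subseteq> C" using annulus_pos restrict_u_pos_iff[OF C] by blast
    then have subK: "annulus \<alpha> R \<subseteq> - K" using C by (auto simp: union_of_components_def)
    have "R * (c\<^sup>2 * flux / (8 * D)) = c\<^sup>2 * (R * flux / (8 * D))" by simp
    also have "\<dots> \<le> c\<^sup>2 * (\<Sum>x\<in>annulus \<alpha> R. restrict_u C x * hardy_weight E (restrict_u C) x)"
      by (intro mult_left_mono \<alpha>[OF that]) simp
    also have "\<dots> = (\<Sum>x\<in>annulus \<alpha> R. (\<psi> x)\<^sup>2 * hardy_weight E u x)"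
      unfolding sum_distrib_left
    proof (rule sum.cong)
      fix x assume "x \<in> annulus \<alpha> R"
      then have "x \<in> C" using sub by blast
      then show "c\<^sup>2 * (restrict_u C x * hardy_weight E (restrict_u C) x) = (\<psi> x)\<^sup>2 * hardy_weight E u x"
        using u_nonneg[of x] hardy_weight_restrict_u[OF C \<open>x \<in> C\<close>]
        by (simp add: C_def restrict_u_def power_mult_distrib)
    qed simp
    finally have "ennreal (R * (c\<^sup>2 * flux / (8 * D))) \<le>
        ennreal (\<Sum>x\<in>annulus \<alpha> R. (\<psi> x)\<^sup>2 * hardy_weight E u x)"
      by (rule ennreal_leI)
    also have "\<dots> = (\<Sum>x\<in>annulus \<alpha> R. ennreal ((\<psi> x)\<^sup>2 * hardy_weight E u x))"
      by (subst sum_ennreal) (auto simp: hardy_weight_nonneg)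
    also have "\<dots> = (\<Sum>\<^sub>\<infinity>x\<in>annulus \<alpha> R. ennreal ((\<psi> x)\<^sup>2 * hardy_weight E u x))"
      using finite_annulus by simp
    also have "\<dots> \<le> ?S"
      by (rule infsum_mono_neutral) (use subK in \<open>auto intro: nonneg_summable_on_complete\<close>)
    finally show ?thesis .
  qed
  show ?thesis
  proof (cases ?S)
    case (real s)
    have "c\<^sup>2 * flux / (8 * D) \<le> 0"
    proof (rule nonpos_if_multiples_bounded)
      fix R :: real assume "R \<ge> 1"
      then show "R * (c\<^sup>2 * flux / (8 * D)) \<le> s" using ge[of R] real by (simp add: ennreal_le_iff)
    qed
    then show ?thesis using c flux_pos D by (simp add: divide_le_0_iff mult_le_0_iff)
  qed auto
qed

text \<open>A vanishing weight would give the ground state \<open>sqrt (u x)\<close> zero mass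
  instead of infinite mass.\<close>

lemma positive_on_hardy_weight: "positive_on (- K) (hardy_weight E u)"
proof -
  have "\<exists>x\<in>- K. hardy_weight E u x \<noteq> 0"
  proof (rule ccontr)
    assume "\<not> ?thesis"
    then have "(\<Sum>\<^sub>\<infinity>x\<in>- K. ennreal ((sqrt (u x))\<^sup>2 * hardy_weight E u x)) = 0"
      by (intro infsum_0) auto
    then show False using ground_state_mass_infinite[OF ground_state_sqrt] by simp
  qed
  then show ?thesis by (simp add: positive_on_def hardy_weight_nonneg)
qed

section \<open>Optimality near infinity\<close>

text \<open>A cutoff with slopes of logarithmic width 1 costs at most \<open>4 * flux\<close>, while
  the weight form over its plateau exceeds any bound once the plateau is long.\<close>

lemma optimal_near_infinity_hardy_weight: "optimal_near_infinity E (- K) (hardy_weight E u)"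
  unfolding optimal_near_infinity_def
proof (intro allI impI notI)
  fix c :: real and W
  let ?w = "hardy_weight E u"
  assume c: "c > 0" and W: "finite W \<and> W \<subseteq> - K"
    and ineq: "\<forall>\<phi>\<in>C_c (- K - W). c * weight_form (- K) ?w \<phi> \<le> energy E \<phi> - weight_form (- K) ?w \<phi>"
  interpret flux_graph E u D by (rule flux_graph_u)
  obtain \<alpha>\<^sub>0 where \<alpha>\<^sub>0: "\<And>\<alpha> R. \<alpha> \<ge> \<alpha>\<^sub>0 \<Longrightarrow> R > 0 \<Longrightarrow>
      R * flux / (8 * D) \<le> (\<Sum>x\<in>annulus \<alpha> R. u x * ?w x)"
    using hardy_mass_annulus_ge by blast
  \<comment> \<open>On \<open>W\<close>, \<open>u\<close> is at most \<open>\<alpha>\<^sub>1\<close>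
    and so at most \<open>exp \<alpha>\<^sub>1\<close>, where the cutoff is still 0. The shift
    \<open>1 + ln D\<close> in \<open>\<alpha>\<close> places the annulus, whose lower end is
    \<open>exp \<alpha> / D\<close>, beyond the rise.\<close>
  define \<alpha>\<^sub>1 where "\<alpha>\<^sub>1 = (\<Sum>x\<in>W. u x)"
  define \<alpha> where "\<alpha> = max \<alpha>\<^sub>0 (\<alpha>\<^sub>1 + 1 + ln D)"
  \<comment> \<open>With this \<open>R\<close> the mass bound times \<open>c\<close> is
    \<open>5 * flux\<close>, more than the cost \<open>4 * flux\<close>. The descent starts at
    \<open>exp \<beta>\<close>, the upper end of the annulus.\<close>
  define R where "R = 40 * D / c"
  define \<beta> where "\<beta> = ln D + (\<alpha> + R)"
  have R: "R > 0" using c D by (simp add: R_def)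
  have "ln D \<ge> 0" using D by simp
  then have "\<alpha>\<^sub>1 \<le> \<beta>" using R by (simp add: \<beta>_def \<alpha>_def)
  define \<phi> where "\<phi> x = sqrt (u x) * log_cutoff \<alpha>\<^sub>1 \<beta> 1 (u x)" for x
  have Y: "x \<in> - K \<and> ?w x = hardy_weight E u x" if "u x > 0" for x
    using that u_zero[of x] by auto
  have "\<phi> x = 0" if "x \<in> W" for x
  proof -
    have "u x \<le> \<alpha>\<^sub>1" unfolding \<alpha>\<^sub>1_def using W that u_nonneg by (intro member_le_sum) auto
    also have "\<dots> \<le> exp (min \<alpha>\<^sub>1 \<beta>)" using \<open>\<alpha>\<^sub>1 \<le> \<beta>\<close> exp_ge_add_one_self[of \<alpha>\<^sub>1] by (simp only: min_absorb1)
    finally show ?thesis by (simp add: \<phi>_def log_cutoff_eq_0)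
  qed
  moreover have "finite {x. \<phi> x \<noteq> 0}"
    unfolding \<phi>_def by (rule energy_cutoff_le(1)[OF _ Y]) simp
  moreover have "\<phi> x = 0" if "x \<in> K" for x using u_zero that by (simp add: \<phi>_def)
  ultimately have \<phi>: "\<phi> \<in> C_c (- K - W)" "\<phi> \<in> C_c (- K)" by (auto simp: C_c_def)
  have "energy E \<phi> - weight_form (- K) ?w \<phi> \<le> 4 * flux"
    using energy_cutoff_le(2)[OF _ Y, of 1 \<alpha>\<^sub>1 \<beta>] by (simp add: \<phi>_def[abs_def])
  moreover have "5 * flux \<le> c * weight_form (- K) ?w \<phi>"
  proof -
    have "5 * flux = c * (R * flux / (8 * D))" using c D by (simp add: R_def)
    also have "\<dots> \<le> c * (\<Sum>x\<in>annulus \<alpha> R. u x * ?w x)"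
      using c R by (intro mult_left_mono \<alpha>\<^sub>0) (auto simp: \<alpha>_def)
    also have "(\<Sum>x\<in>annulus \<alpha> R. u x * ?w x) = (\<Sum>x\<in>annulus \<alpha> R. ?w x * (\<phi> x)\<^sup>2)"
    proof (rule sum.cong)
      fix x assume x: "x \<in> annulus \<alpha> R"
      have "log_cutoff \<alpha>\<^sub>1 \<beta> 1 (u x) = 1"
      proof (rule log_cutoff_eq_1)
        have "exp (\<alpha>\<^sub>1 + 1) \<le> exp (\<alpha> - ln D)" by (simp add: \<alpha>_def)
        also have "\<dots> = exp \<alpha> / D" using D by (simp add: exp_diff)
        also have "\<dots> \<le> u x" using x by (simp add: annulus_def)
        finally show "exp (\<alpha>\<^sub>1 + 1) \<le> u x" .
        have "u x \<le> D * exp (\<alpha> + R)" using x by (simp add: annulus_def)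
        also have "\<dots> = exp \<beta>" using D by (simp add: \<beta>_def exp_add)
        finally show "u x \<le> exp \<beta>" .
      qed simp
      then show "u x * ?w x = ?w x * (\<phi> x)\<^sup>2" using u_nonneg by (simp add: \<phi>_def)
    qed simp
    also have "\<dots> \<le> weight_form (- K) ?w \<phi>"
      using \<phi> Y annulus_pos finite_annulus by (intro weight_form_ge) (auto simp: hardy_weight_nonneg)
    finally show ?thesis using c by simp
  qed
  ultimately show False using ineq \<phi>(1) flux_pos by fastforce
qed

end

theorem theorem0p1:
  fixes E :: "'a \<Rightarrow> 'a \<Rightarrow> bool" and K :: "'a set" and u :: "'a \<Rightarrow> real"
  assumes "countable (UNIV :: 'a set)" and "infinite (UNIV :: 'a set)"
    and "symp E" and "irreflp E"
    and "connected_graph E" and "bounded_degree E"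
    and "finite K"
    and "positive_on UNIV u" and "\<not> bounded (range u)"
    and "harmonic_on E (- K) u"
    and "proper_on (- K) {0<..} u"
    and "\<forall>x\<in>- K. u x > 0"
    and "\<forall>x\<in>K. u x = 0"
  shows "(\<forall>\<phi>\<in>C_c (- K). energy E \<phi> \<ge> (\<Sum>\<^sub>\<infinity>x\<in>- K. hardy_weight E u x * (\<phi> x)\<^sup>2)) \<and>
         optimal_hardy_weight E (- K) (hardy_weight E u)"
proof -
  obtain D\<^sub>0 where D\<^sub>0: "\<And>x. finite (neighbours E x) \<and> card (neighbours E x) \<le> D\<^sub>0"
    using assms(6) by (auto simp: bounded_degree_def)
  \<comment> \<open>The successor ensures that the constant is at least 1.\<close>
  interpret proper_harmonic E K u "real (Suc D\<^sub>0)"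
  proof
    show "finite {x. a \<le> u x \<and> u x \<le> b}" if "a > 0" for a b
    proof -
      have "{a..b} \<subseteq> {0<..}" using that by auto
      then have "finite (u -` {a..b})"
        using assms(11) unfolding proper_on_def by blast
      then show ?thesis by (simp add: vimage_def)
    qed
    show "finite (neighbours E x)" "real (card (neighbours E x)) \<le> real (Suc D\<^sub>0)" for x
      using D\<^sub>0[of x] by simp_all
    show "laplacian E u x = 0" "u x > 0" if "x \<notin> K" for x
      using that assms(10,12) by (simp_all add: harmonic_on_def)
    show "u x = 0" if "x \<in> K" for x
      using that assms(13) by blast
  qed (fact assms | simp)+
  show ?thesis
    unfolding weight_form_def[symmetric] optimal_hardy_weight_def null_critical_def
    using hardy_inequality positive_on_hardy_weight critical_hardy_weight ground_state_sqrt
      ground_state_mass_infinite optimal_near_infinity_hardy_weight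
    by simp blast
qed

end
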